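(* Let $(a_0(n))_n$ and $(a_1(n))_n$ be real sequences with $2a_0(n)+a_1(n)=1$ for all $n$, and let $D_n^{M,1}$ be the associated modified Durrmeyer operators. Then for every $f\in C[0,1]$, every $x\in[0,1]$ and every integer $n\ge1$, \begin{align*} \left|D_n^{M,1}(f;x)-f(x)\right|&\le\left|D_n(f;x)-f(x)\right|\\ &\quad+\left|(1+a_1(n))\left(\tfrac12-x\right)\right|\left\{3\,\omega_2\!\left(f;\sqrt{\sigma_n(x)}\right)+\frac{5}{(n+2)\sqrt{\sigma_n(x)}}\,\omega_1\!\left(f;\sqrt{\sigma_n(x)}\right)\right\}, \end{align*} where $$\sigma_n(x)=\frac{2x(1-x)(n-1)(n-2)+3n+1}{2(n+2)^2(n+3)}.$$
   Context: Bernstein basis: $p_{n,k}(x)=\binom nk x^k(1-x)^{n-k}$ for $0\le k\le n$, $x\in[0,1]$ (with $0^0=1$), and $p_{n,k}=0$ if $k<0$ or $k>n$. Classical Durrmeyer operator: $D_n(f;x)=(n+1)\sum_{k=0}^n p_{n,k}(x)\int_0^1p_{n,k}(t)f(t)\,dt$. Modified basis: given real sequences $a_0(n),a_1(n)$, put $a(x,n)=a_1(n)x+a_0(n)$ and, for $0\le k\le n$, $$p_{n,k}^{M,1}(x)=a(x,n)\,p_{n-1,k}(x)+a(1-x,n)\,p_{n-1,k-1}(x).$$ Modified Durrmeyer operator: $D_n^{M,1}(f;x)=(n+1)\sum_{k=0}^n p_{n,k}^{M,1}(x)\int_0^1p_{n,k}(t)f(t)\,dt$. (No positivity is assumed.)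 Moduli, for $g\in C[0,1]$ and $\delta>0$: $\omega_1(g;\delta)=\sup\{|g(s)-g(t)|: s,t\in[0,1],\ |s-t|\le\delta\}$ and $\omega_2(g;\delta)=\sup\{|g(t-h)-2g(t)+g(t+h)|: 0\le h\le\delta,\ t\pm h\in[0,1]\}$. *)

theory Defs
  imports "HOL-Analysis.Analysis"
begin

text \<open>The basis \<open>p\<^sub>n\<^sub>,\<^sub>k(x)\<close> is the library's \<^const>\<open>Bernstein\<close>; it vanishes for \<open>k > n\<close>
  because the binomial coefficient does, and \<open>0 ^ 0 = 1\<close>.\<close>

definition durrmeyer :: "nat \<Rightarrow> (real \<Rightarrow> real) \<Rightarrow> real \<Rightarrow> real" where
  "durrmeyer n f x =
     (real n + 1) * (\<Sum>k=0..n. Bernstein n k x * integral {0..1} (\<lambda>t. Bernstein n k t * f t))"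

definition mod_coeff :: "(nat \<Rightarrow> real) \<Rightarrow> (nat \<Rightarrow> real) \<Rightarrow> real \<Rightarrow> nat \<Rightarrow> real" where
  "mod_coeff a0 a1 x n = a1 n * x + a0 n"

text \<open>Only meaningful for \<open>n \<ge> 1\<close>, since \<open>n - 1\<close> is truncated. The case distinction renders the
  convention \<open>p\<^sub>n\<^sub>,\<^sub>k = 0\<close> for \<open>k < 0\<close>.\<close>

definition mod_Bernstein ::
    "(nat \<Rightarrow> real) \<Rightarrow> (nat \<Rightarrow> real) \<Rightarrow> nat \<Rightarrow> nat \<Rightarrow> real \<Rightarrow> real" where
  "mod_Bernstein a0 a1 n k x =
     mod_coeff a0 a1 x n * Bernstein (n - 1) k x
     + mod_coeff a0 a1 (1 - x) n * (if k = 0 then 0 else Bernstein (n - 1) (k - 1) x)"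

definition mod_durrmeyer ::
    "(nat \<Rightarrow> real) \<Rightarrow> (nat \<Rightarrow> real) \<Rightarrow> nat \<Rightarrow> (real \<Rightarrow> real) \<Rightarrow> real \<Rightarrow> real" where
  "mod_durrmeyer a0 a1 n f x =
     (real n + 1) * (\<Sum>k=0..n. mod_Bernstein a0 a1 n k x
                               * integral {0..1} (\<lambda>t. Bernstein n k t * f t))"

text \<open>The suprema below are over nonempty sets for \<open>\<delta> > 0\<close>, bounded above for \<open>g\<close> continuous
  on \<open>{0..1}\<close>; outside these conditions the values carry no meaning.\<close>

definition omega1 :: "(real \<Rightarrow> real) \<Rightarrow> real \<Rightarrow> real" where
  "omega1 g \<delta> = Sup {\<bar>g s - g t\<bar> | s t. s \<in> {0..1} \<and> t \<in> {0..1} \<and> \<bar>s - t\<bar> \<le> \<delta>}"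

definition omega2 :: "(real \<Rightarrow> real) \<Rightarrow> real \<Rightarrow> real" where
  "omega2 g \<delta> = Sup {\<bar>g (t - h) - 2 * g t + g (t + h)\<bar> | t h.
                      0 \<le> h \<and> h \<le> \<delta> \<and> t - h \<in> {0..1} \<and> t + h \<in> {0..1}}"

definition durrmeyer_sigma :: "nat \<Rightarrow> real \<Rightarrow> real" where
  "durrmeyer_sigma n x =
     (2 * x * (1 - x) * (real n - 1) * (real n - 2) + 3 * real n + 1)
     / (2 * (real n + 2)\<^sup>2 * (real n + 3))"

end

theory Submission
  imports Defs
begin

text \<open>The operators differ by
  \<open>(1 + a\<^sub>1(n)) (x - 1/2) \<Sum>\<^sub>k p\<^sub>n\<^sub>-\<^sub>1\<^sub>,\<^sub>k(x) \<integral> q\<^sub>k' f\<close> with \<open>q\<^sub>k = p\<^sub>n\<^sub>+\<^sub>1\<^sub>,\<^sub>k\<^sub>+\<^sub>1\<close>, which vanishes at both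
  end points. Cut \<open>[0,1]\<close> into \<open>N\<close> cells of length between \<open>\<delta>/5\<close> and \<open>\<delta>\<close>, where
  \<open>\<delta> = \<surd>\<sigma>\<^sub>n(x)\<close>, and split \<open>f\<close> on each cell into its linear interpolant and a remainder. Integrating
  the linear parts by parts, the boundary terms telescope to zero, and the slopes, which are at most
  \<open>5\<omega>\<^sub>1/\<delta>\<close>, meet \<open>\<integral> q\<^sub>k = 1/(n+2)\<close>. The remainder is at most \<open>\<omega>\<^sub>2\<close> and meets \<open>\<integral> |q\<^sub>k'| \<le> 2\<close>.\<close>

section \<open>Moduli of continuity\<close>

lemma continuous_on_unit_bound:
  fixes f :: "real \<Rightarrow> real"
  assumes "continuous_on {0..1} f"
  obtains B where "\<And>t. t \<in> {0..1} \<Longrightarrow> \<bar>f t\<bar> \<le> B"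
proof -
  have "bounded (f ` {0..1})"
    using assms by (intro compact_imp_bounded compact_continuous_image) auto
  then obtain B where "\<forall>t\<in>{0..1}. \<bar>f t\<bar> \<le> B"
    by (auto simp: bounded_iff)
  then show ?thesis
    using that by blast
qed

text \<open>By compactness \<open>f\<close> is bounded, so the set under \<open>Sup\<close> is
  bounded above and its members lie below \<open>Sup\<close>. The same argument serves
  \<open>omega2\<close>.\<close>

lemma omega1_upper:
  assumes "continuous_on {0..1} f" "s \<in> {0..1}" "t \<in> {0..1}" "\<bar>s - t\<bar> \<le> \<delta>"
  shows "\<bar>f s - f t\<bar> \<le> omega1 f \<delta>"
  unfolding omega1_def
proof (rule cSup_upper)
  show "\<bar>f s - f t\<bar> \<in> {\<bar>f s - f t\<bar> |s t. s \<in> {0..1} \<and> t \<in> {0..1} \<and> \<bar>s - t\<bar> \<le> \<delta>}"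
    using assms by blast
  obtain B where B: "\<And>t. t \<in> {0..1} \<Longrightarrow> \<bar>f t\<bar> \<le> B"
    using continuous_on_unit_bound[OF assms(1)] by blast
  show "bdd_above {\<bar>f s - f t\<bar> |s t. s \<in> {0..1} \<and> t \<in> {0..1} \<and> \<bar>s - t\<bar> \<le> \<delta>}"
  proof (rule bdd_aboveI[of _ "2 * B"], clarify)
    fix s t :: real
    assume "s \<in> {0..1}" "t \<in> {0..1}"
    then show "\<bar>f s - f t\<bar> \<le> 2 * B"
      using B[of s] B[of t] by linarith
  qed
qed

lemma omega2_upper:
  assumes "continuous_on {0..1} f" "0 \<le> h" "h \<le> \<delta>" "t - h \<in> {0..1}" "t + h \<in> {0..1}"
  shows "\<bar>f (t - h) - 2 * f t + f (t + h)\<bar> \<le> omega2 f \<delta>"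
  unfolding omega2_def
proof (rule cSup_upper)
  let ?S = "{\<bar>f (t - h) - 2 * f t + f (t + h)\<bar> |t h.
              0 \<le> h \<and> h \<le> \<delta> \<and> t - h \<in> {0..1} \<and> t + h \<in> {0..1}}"
  show "\<bar>f (t - h) - 2 * f t + f (t + h)\<bar> \<in> ?S"
    using assms by blast
  obtain B where B: "\<And>t. t \<in> {0..1} \<Longrightarrow> \<bar>f t\<bar> \<le> B"
    using continuous_on_unit_bound[OF assms(1)] by blast
  show "bdd_above ?S"
  proof (rule bdd_aboveI[of _ "4 * B"], clarify)
    fix t h :: real
    assume "0 \<le> h" "t - h \<in> {0..1}" "t + h \<in> {0..1}"
    then show "\<bar>f (t - h) - 2 * f t + f (t + h)\<bar> \<le> 4 * B"
      using B[of "t - h"] B[of t] B[of "t + h"] by auto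
  qed
qed

lemma omega2_nonneg:
  assumes "continuous_on {0..1} f" "0 \<le> \<delta>"
  shows "0 \<le> omega2 f \<delta>"
  using omega2_upper[OF assms(1), of 0 \<delta> 0] assms(2) by simp

text \<open>At a maximum point \<open>t\<close> of the error \<open>|r|\<close>, centre a second difference at \<open>t\<close> reaching to the
  nearer end of the interval, where \<open>r = 0\<close>: it is at least \<open>2|r(t)| - |r(t)|\<close>.\<close>

lemma linear_interpolation_error:
  fixes f :: "real \<Rightarrow> real"
  assumes f: "continuous_on {0..1} f" and ab: "0 \<le> a" "a < b" "b \<le> 1" "b - a \<le> 2 * \<delta>"
    and t: "t \<in> {a..b}"
  shows "\<bar>f t - (f a + (f b - f a) / (b - a) * (t - a))\<bar> \<le> omega2 f \<delta>"
proof -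
  define s where "s = (f b - f a) / (b - a)"
  define r where "r u = f u - (f a + s * (u - a))" for u
  have r0: "r a = 0" "r b = 0"
    using ab by (simp_all add: r_def s_def)
  have "continuous_on {a..b} (\<lambda>u. \<bar>r u\<bar>)"
    unfolding r_def using ab by (intro continuous_intros continuous_on_subset[OF f]) auto
  then obtain u where u: "u \<in> {a..b}" and max: "\<And>v. v \<in> {a..b} \<Longrightarrow> \<bar>r v\<bar> \<le> \<bar>r u\<bar>"
    using continuous_attains_sup[of "{a..b}" "\<lambda>u. \<bar>r u\<bar>"] ab by auto
  \<comment> \<open>Second differences annihilate affine functions, so \<open>r\<close> may be
    replaced by \<open>f\<close>; and \<open>u - d\<close>, \<open>u + d\<close> both in
    \<open>[a,b]\<close> forces \<open>2 d \<le> b - a\<close>, hence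
    \<open>d \<le> \<delta>\<close>.\<close>
  have diff: "\<bar>r (u - d) - 2 * r u + r (u + d)\<bar> \<le> omega2 f \<delta>"
    if "0 \<le> d" "u - d \<in> {a..b}" "u + d \<in> {a..b}" for d
  proof -
    have "r (u - d) - 2 * r u + r (u + d) = f (u - d) - 2 * f u + f (u + d)"
      by (simp add: r_def algebra_simps)
    then show ?thesis
      using omega2_upper[OF f, of d \<delta> u] that ab by auto
  qed
  have "\<bar>r u\<bar> \<le> omega2 f \<delta>"
  proof (cases "2 * u \<le> a + b")
    case True
    then show ?thesis
      using diff[of "u - a"] max[of "u + (u - a)"] u r0 by auto
  next
    case False
    then show ?thesis
      using diff[of "b - u"] max[of "u - (b - u)"] u r0 by auto
  qed
  then show ?thesis
    using max[OF t] by (simp add: r_def s_def)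
qed

section \<open>Integration against a derivative\<close>

text \<open>With \<open>L\<close> the linear interpolant and \<open>s\<close> its slope,
  \<open>q' f = (q L)' - s q + q' (f - L)\<close>. The three terms give the boundary values, the
  \<open>S\<close> term and the \<open>omega2\<close> term. A majorant \<open>w\<close> of
  \<open>|q'|\<close> with a known integral avoids discussing the sign of \<open>q'\<close>.\<close>

lemma cell_estimate:
  fixes f q q' w :: "real \<Rightarrow> real"
  assumes f: "continuous_on {0..1} f"
    and ab: "0 \<le> a" "a < b" "b \<le> 1" "b - a \<le> 2 * \<delta>"
    and slope: "\<bar>f b - f a\<bar> \<le> S * (b - a)"
    and q: "\<And>t. (q has_real_derivative q' t) (at t)"
    and q': "continuous_on UNIV q'"
    and qnn: "\<And>t. t \<in> {0..1} \<Longrightarrow> 0 \<le> q t"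
    and w: "continuous_on UNIV w" "\<And>t. t \<in> {0..1} \<Longrightarrow> \<bar>q' t\<bar> \<le> w t"
  shows "\<bar>integral {a..b} (\<lambda>t. q' t * f t) - (q b * f b - q a * f a)\<bar>
           \<le> S * integral {a..b} q + omega2 f \<delta> * integral {a..b} w"
proof -
  define s where "s = (f b - f a) / (b - a)"
  define L where "L t = f a + s * (t - a)" for t
  have L: "L a = f a" "L b = f b"
    using ab by (simp_all add: L_def s_def)
  have qc: "continuous_on UNIV q"
    using q DERIV_continuous_on by blast
  note [continuous_intros] =
    continuous_on_subset[OF qc subset_UNIV] continuous_on_subset[OF q' subset_UNIV]
    continuous_on_subset[OF w(1) subset_UNIV]
  have fc: "continuous_on {a..b} f"
    using ab by (intro continuous_on_subset[OF f]) auto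
  have int: "(\<lambda>t. q' t * (f t - L t)) integrable_on {a..b}" "q integrable_on {a..b}"
    "w integrable_on {a..b}"
    unfolding L_def by (intro integrable_continuous_real continuous_intros fc)+
  have "((\<lambda>t. q' t * L t + q t * s) has_integral (q b * L b - q a * L a)) {a..b}"
  proof (rule fundamental_theorem_of_calculus)
    show "((\<lambda>t. q t * L t) has_vector_derivative q' t * L t + q t * s) (at t within {a..b})" for t
      unfolding has_real_derivative_iff_has_vector_derivative[symmetric] L_def
      by (rule DERIV_subset[where s = UNIV])
        (auto intro!: derivative_eq_intros q simp: algebra_simps)
  qed (use ab in simp)
  from has_integral_add[OF this integrable_integral[OF int(1)]]
  have "((\<lambda>t. q' t * f t + s * q t) has_integral
      q b * f b - q a * f a + integral {a..b} (\<lambda>t. q' t * (f t - L t))) {a..b}"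
    by (simp add: algebra_simps L)
  from has_integral_diff[OF this has_integral_mult_right[OF integrable_integral[OF int(2)], of s]]
  have "integral {a..b} (\<lambda>t. q' t * f t) - (q b * f b - q a * f a)
      = integral {a..b} (\<lambda>t. q' t * (f t - L t)) - s * integral {a..b} q"
    by (auto dest!: integral_unique)
  moreover have "\<bar>integral {a..b} (\<lambda>t. q' t * (f t - L t))\<bar> \<le> integral {a..b} (\<lambda>t. omega2 f \<delta> * w t)"
  proof (subst real_norm_def[symmetric], rule integral_norm_bound_integral)
    fix t assume t: "t \<in> {a..b}"
    then have "\<bar>q' t\<bar> * \<bar>f t - L t\<bar> \<le> w t * omega2 f \<delta>"
      using ab w(2)[of t] linear_interpolation_error[OF f ab t]
      unfolding L_def s_def by (intro mult_mono) auto
    then show "norm (q' t * (f t - L t)) \<le> omega2 f \<delta> * w t"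
      by (simp add: abs_mult mult.commute)
  qed (use int in \<open>auto intro!: integrable_continuous_real continuous_intros\<close>)
  moreover have "\<bar>s * integral {a..b} q\<bar> \<le> S * integral {a..b} q"
  proof -
    have "0 \<le> integral {a..b} q"
      using int(2) qnn ab by (intro integral_nonneg) auto
    moreover have "\<bar>s\<bar> \<le> S"
      using slope ab by (simp add: s_def divide_le_eq)
    ultimately show ?thesis
      by (simp add: abs_mult mult_right_mono)
  qed
  ultimately show ?thesis
    by simp
qed

text \<open>Induction over the cells \<open>[m/N, (m+1)/N]\<close>: the boundary term at a shared
  node cancels, and those at 0 and 1 vanish with \<open>q\<close>.\<close>

lemma integral_derivative_times_bound:
  fixes f q q' w :: "real \<Rightarrow> real"
  assumes f: "continuous_on {0..1} f"
    and N: "0 < N" "1 / real N \<le> \<delta>"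
    and q: "\<And>t. (q has_real_derivative q' t) (at t)"
    and q': "continuous_on UNIV q'"
    and qnn: "\<And>t. t \<in> {0..1} \<Longrightarrow> 0 \<le> q t"
    and w: "continuous_on UNIV w" "\<And>t. t \<in> {0..1} \<Longrightarrow> \<bar>q' t\<bar> \<le> w t"
    and q01: "q 0 = 0" "q 1 = 0"
  shows "\<bar>integral {0..1} (\<lambda>t. q' t * f t)\<bar>
           \<le> real N * omega1 f \<delta> * integral {0..1} q + omega2 f \<delta> * integral {0..1} w"
proof -
  define S where "S = real N * omega1 f \<delta>"
  have qc: "continuous_on UNIV q"
    using q DERIV_continuous_on by blast
  have int: "(\<lambda>t. q' t * f t) integrable_on {a..b}" "q integrable_on {a..b}"
    "w integrable_on {a..b}" if "0 \<le> a" "b \<le> 1" for a b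
    using that by (auto intro!: integrable_continuous_real continuous_on_mult
        continuous_on_subset[OF f] continuous_on_subset[OF q'] continuous_on_subset[OF qc]
        continuous_on_subset[OF w(1)])
  have "m \<le> N \<Longrightarrow>
    \<bar>integral {0..real m / real N} (\<lambda>t. q' t * f t) - q (real m / real N) * f (real m / real N)\<bar>
      \<le> S * integral {0..real m / real N} q + omega2 f \<delta> * integral {0..real m / real N} w" for m
  proof (induction m)
    case 0
    show ?case by (simp add: q01)
  next
    case (Suc m)
    define a b where "a = real m / real N" and "b = real (Suc m) / real N"
    have ab: "0 \<le> a" "a < b" "b \<le> 1" and len: "b - a = 1 / real N"
      using Suc.prems N by (auto simp: a_def b_def field_simps)
    \<comment> \<open>The cell has length \<open>1/N \<le> \<delta>\<close>, so the increment is at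
      most \<open>omega1 f \<delta>\<close>, which is exactly \<open>S (b - a)\<close>.\<close>
    have 1: "\<bar>f b - f a\<bar> \<le> S * (b - a)"
      using omega1_upper[OF f, of b a \<delta>] ab len N by (auto simp: S_def)
    have 2: "b - a \<le> 2 * \<delta>"
      using len N by (smt (verit) zero_less_divide_1_iff of_nat_0_less_iff)
    have comb: "integral {0..b} g = integral {0..a} g + integral {a..b} g"
      if "g integrable_on {0..b}" for g :: "real \<Rightarrow> real"
      using Henstock_Kurzweil_Integration.integral_combine[of 0 a b g] ab that by simp
    show ?case
      using Suc cell_estimate[OF f ab 2 1 q q' qnn w] comb[OF int(1)] comb[OF int(2)]
        comb[OF int(3)] ab
      by (simp add: a_def[symmetric] b_def[symmetric] distrib_left del: of_nat_Suc)
  qed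
  from this[of N] show ?thesis
    using N by (simp add: S_def q01)
qed

section \<open>Bernstein polynomials\<close>

lemma Bernstein_Suc_Suc:
  "Bernstein (Suc n) (Suc k) x = x * Bernstein n k x + (1 - x) * Bernstein n (Suc k) x"
proof (cases "k < n")
  case True
  then have "n - k = Suc (n - Suc k)" by simp
  then show ?thesis by (simp add: Bernstein_def algebra_simps)
next
  case False
  then show ?thesis by (cases "k = n") (simp_all add: Bernstein_def binomial_eq_0)
qed

lemma Bernstein_eq_0: "n < k \<Longrightarrow> Bernstein n k x = 0"
  by (simp add: Bernstein_def)

lemma continuous_on_Bernstein [continuous_intros]: "continuous_on A (Bernstein n k)"
  unfolding Bernstein_def by (intro continuous_intros)

lemma DERIV_Bernstein:
  assumes "k \<le> n"
  shows "(Bernstein (Suc n) (Suc k) has_real_derivative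
           (real n + 1) * (Bernstein n k x - Bernstein n (Suc k) x)) (at x)"
proof -
  \<comment> \<open>Two absorption identities turn both terms of the product rule into basis
    functions of degree \<open>n\<close>.\<close>
  have 1: "real (Suc n choose Suc k) * (real k + 1) = (real n + 1) * real (n choose k)"
    using arg_cong[OF Suc_times_binomial_eq[of n k], of real]
    by (simp add: algebra_simps del: binomial_Suc_Suc)
  have 2: "real (Suc n choose Suc k) * real (n - k) = (real n + 1) * real (n choose Suc k)"
    using arg_cong[OF binomial_absorb_comp[of "Suc n" "Suc k"], of real]
    by (simp add: distrib_right mult.commute[of "real (Suc n choose Suc k)"] add.commute
        del: binomial_Suc_Suc)
  \<comment> \<open>For \<open>k = n\<close> the exponent \<open>n - Suc k\<close> is truncated, but
    its term carries the factor \<open>n - k = 0\<close>.\<close>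
  have "((\<lambda>x. real (Suc n choose Suc k) * x ^ Suc k * (1 - x) ^ (n - k)) has_real_derivative
      (real (Suc n choose Suc k) * (real k + 1)) * x ^ k * (1 - x) ^ (n - k)
      - (real (Suc n choose Suc k) * real (n - k)) * x ^ Suc k * (1 - x) ^ (n - Suc k)) (at x)"
    by (auto intro!: derivative_eq_intros simp: algebra_simps
        simp del: binomial_Suc_Suc power_Suc)
  then show ?thesis
    unfolding 1 2 by (simp add: Bernstein_def[abs_def] algebra_simps del: binomial_Suc_Suc)
qed

text \<open>The integrals over \<open>[0,1]\<close> of \<open>p\<^sub>n\<^sub>,\<^sub>k\<close> and \<open>p\<^sub>n\<^sub>,\<^sub>k\<^sub>+\<^sub>1\<close> agree because the difference is a multiple of
  \<open>p'\<^sub>n\<^sub>+\<^sub>1\<^sub>,\<^sub>k\<^sub>+\<^sub>1\<close>, and the \<open>n + 1\<close> equal integrals sum to 1.\<close>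

lemma integral_Bernstein:
  assumes "k \<le> n"
  shows "integral {0..1} (Bernstein n k) = 1 / (real n + 1)"
proof -
  have int: "Bernstein n k integrable_on {0..1}" for k
    by (intro integrable_continuous_real continuous_intros)
  have step: "integral {0..1} (Bernstein n (Suc k)) = integral {0..1} (Bernstein n k)"
    if "k < n" for k
  proof -
    \<comment> \<open>The value at 1 vanishes because \<open>k < n\<close> leaves a positive power
      of \<open>1 - x\<close>.\<close>
    have end_pts: "Bernstein (Suc n) (Suc k) 1 = 0" "Bernstein (Suc n) (Suc k) 0 = 0"
      using that by (simp_all add: Bernstein_def)
    have 1: "((\<lambda>x. (real n + 1) * (Bernstein n k x - Bernstein n (Suc k) x)) has_integral
        Bernstein (Suc n) (Suc k) 1 - Bernstein (Suc n) (Suc k) 0) {0..1}"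
      using that
      by (intro fundamental_theorem_of_calculus)
        (auto simp: has_real_derivative_iff_has_vector_derivative[symmetric]
          intro!: DERIV_subset[OF DERIV_Bernstein])
    have 2: "((\<lambda>x. (real n + 1) * (Bernstein n k x - Bernstein n (Suc k) x)) has_integral
        (real n + 1) * (integral {0..1} (Bernstein n k) - integral {0..1} (Bernstein n (Suc k))))
        {0..1}"
      by (intro has_integral_mult_right has_integral_diff integrable_integral int)
    show ?thesis
      using has_integral_unique[OF 2 1] by (simp add: end_pts add_nonneg_eq_0_iff)
  qed
  have const: "integral {0..1} (Bernstein n j) = integral {0..1} (Bernstein n 0)" if "j \<le> n" for j
    using that by (induction j) (simp_all add: step)
  have "(\<Sum>j\<le>n. integral {0..1} (Bernstein n 0)) = (\<Sum>j\<le>n. integral {0..1} (Bernstein n j))"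
    by (intro sum.cong refl const[symmetric]) simp
  also have "\<dots> = integral {0..1} (\<lambda>x. \<Sum>j\<le>n. Bernstein n j x)"
    by (intro integral_sum[symmetric] int) auto
  finally have "(real n + 1) * integral {0..1} (Bernstein n 0) = 1"
    by (simp add: add.commute)
  then have "integral {0..1} (Bernstein n 0) = 1 / (real n + 1)"
    by (intro eq_divide_imp) (simp_all add: mult.commute)
  with const[OF assms] show ?thesis
    by (rule trans)
qed

text \<open>The left side is \<open>|\<integral> q' f|\<close> for \<open>q = p_{n+1,k+1}\<close>.
  Replacing the difference in \<open>q'\<close> by a sum gives the majorant, whose integral is 2
  since each basis function integrates to \<open>1/(n+1)\<close>.\<close>

lemma Bernstein_weight_difference_bound:
  fixes f :: "real \<Rightarrow> real"
  assumes f: "continuous_on {0..1} f" and N: "0 < N" "1 / real N \<le> \<delta>" and k: "k < n"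
  shows "(real n + 1) * \<bar>integral {0..1} (\<lambda>t. Bernstein n k t * f t)
            - integral {0..1} (\<lambda>t. Bernstein n (Suc k) t * f t)\<bar>
         \<le> real N * omega1 f \<delta> / (real n + 2) + 2 * omega2 f \<delta>"
proof -
  let ?q = "Bernstein (Suc n) (Suc k)"
  let ?q' = "\<lambda>t. (real n + 1) * (Bernstein n k t - Bernstein n (Suc k) t)"
  let ?w = "\<lambda>t. (real n + 1) * (Bernstein n k t + Bernstein n (Suc k) t)"
  have int: "Bernstein n k integrable_on {0..1}" for k
    by (intro integrable_continuous_real continuous_intros)
  have intf: "(\<lambda>t. Bernstein n k t * f t) integrable_on {0..1}" for k
    by (intro integrable_continuous_real continuous_intros f)
  have "\<bar>integral {0..1} (\<lambda>t. ?q' t * f t)\<bar>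
      \<le> real N * omega1 f \<delta> * integral {0..1} ?q + omega2 f \<delta> * integral {0..1} ?w"
  proof (rule integral_derivative_times_bound[OF f N])
    show "(?q has_real_derivative ?q' t) (at t)" for t
      using k by (intro DERIV_Bernstein) simp
    show "\<bar>?q' t\<bar> \<le> ?w t" if "t \<in> {0..1}" for t
      using Bernstein_nonneg[of t n k] Bernstein_nonneg[of t n "Suc k"] that
      by (simp add: abs_mult abs_le_iff)
  qed (use k in \<open>auto intro!: continuous_intros Bernstein_nonneg simp: Bernstein_def\<close>)
  moreover have "integral {0..1} (\<lambda>t. ?q' t * f t) =
      (real n + 1) * (integral {0..1} (\<lambda>t. Bernstein n k t * f t)
            - integral {0..1} (\<lambda>t. Bernstein n (Suc k) t * f t))"
    using Henstock_Kurzweil_Integration.integral_diff[OF intf[of k] intf[of "Suc k"]]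
    by (simp add: left_diff_distrib mult.assoc)
  moreover have "integral {0..1} ?w =
      (real n + 1) * (integral {0..1} (Bernstein n k) + integral {0..1} (Bernstein n (Suc k)))"
    using Henstock_Kurzweil_Integration.integral_add[OF int[of k] int[of "Suc k"]] by simp
  moreover have "\<dots> = 2"
    using k by (simp add: integral_Bernstein field_simps)
  moreover have "integral {0..1} ?q = 1 / (real n + 2)"
    using k by (simp add: integral_Bernstein add.commute)
  ultimately show ?thesis
    by (simp add: abs_mult mult.commute)
qed

section \<open>The modified operator\<close>

text \<open>Expand \<open>p_{n,k}\<close> by the degree recursion and compare coefficients:
  \<open>a(x,n) - (1 - x)\<close> and \<open>a(1-x,n) - x\<close> are
  \<open>(1 + a1 n) (x - 1/2)\<close> and its negative.\<close>

lemma mod_Bernstein_diff: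
  assumes "2 * a0 n + a1 n = 1" "n = Suc m"
  shows "mod_Bernstein a0 a1 n k x - Bernstein n k x =
    (1 + a1 n) * (x - 1 / 2)
    * (Bernstein m k x - (if k = 0 then 0 else Bernstein m (k - 1) x))"
proof -
  have a0: "a0 n = (1 - a1 n) / 2" and n: "n - 1 = m"
    using assms by simp_all
  show ?thesis
  proof (cases k)
    case 0
    have "Bernstein n 0 x = (1 - x) * Bernstein m 0 x"
      by (simp add: Bernstein_def assms(2))
    then show ?thesis
      unfolding mod_Bernstein_def mod_coeff_def a0 n 0 by (simp add: field_simps)
  next
    case (Suc j)
    have "Bernstein n (Suc j) x = x * Bernstein m j x + (1 - x) * Bernstein m (Suc j) x"
      by (simp add: assms(2) Bernstein_Suc_Suc)
    then show ?thesis
      unfolding mod_Bernstein_def mod_coeff_def a0 n Suc by (simp add: field_simps)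
  qed
qed

text \<open>Summation by parts moves the difference in \<open>k\<close> from the basis functions to
  the integrals.\<close>

lemma mod_durrmeyer_diff:
  assumes "2 * a0 n + a1 n = 1" "n = Suc m"
  shows "mod_durrmeyer a0 a1 n f x - durrmeyer n f x =
    (1 + a1 n) * (x - 1 / 2) * (\<Sum>k\<le>m. Bernstein m k x *
      ((real n + 1) * (integral {0..1} (\<lambda>t. Bernstein n k t * f t)
            - integral {0..1} (\<lambda>t. Bernstein n (Suc k) t * f t))))"
proof -
  define I where "I k = integral {0..1} (\<lambda>t. Bernstein n k t * f t)" for k
  define c where "c = (1 + a1 n) * (x - 1 / 2)"
  have shift: "(\<Sum>k\<le>n. (if k = 0 then 0 else Bernstein m (k - 1) x) * I k)
      = (\<Sum>k\<le>m. Bernstein m k x * I (Suc k))"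
    unfolding assms(2) by (subst sum.atMost_Suc_shift) simp
  have "mod_durrmeyer a0 a1 n f x - durrmeyer n f x
      = (real n + 1) * (\<Sum>k\<le>n. (mod_Bernstein a0 a1 n k x - Bernstein n k x) * I k)"
    by (simp add: mod_durrmeyer_def durrmeyer_def I_def atLeast0AtMost sum_subtractf algebra_simps)
  also have "\<dots> = (real n + 1) * (c * ((\<Sum>k\<le>n. Bernstein m k x * I k)
      - (\<Sum>k\<le>n. (if k = 0 then 0 else Bernstein m (k - 1) x) * I k)))"
    unfolding mod_Bernstein_diff[of a0 n a1, OF assms] c_def[symmetric] sum_subtractf[symmetric]
    by (simp only: sum_distrib_left left_diff_distrib right_diff_distrib mult.assoc)
  also have "\<dots> = (real n + 1) * (c * (\<Sum>k\<le>m. Bernstein m k x * (I k - I (Suc k))))"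
    \<comment> \<open>The top term \<open>k = n\<close> of the first sum drops out, as
      \<open>p_{m,n} = 0\<close> for \<open>n = m + 1\<close>.\<close>
    unfolding shift by (simp add: assms(2) Bernstein_eq_0 sum_subtractf right_diff_distrib)
  also have "\<dots> = c * (\<Sum>k\<le>m. Bernstein m k x * ((real n + 1) * (I k - I (Suc k))))"
    by (simp only: sum_distrib_left mult_ac)
  finally show ?thesis
    by (simp only: c_def I_def)
qed

lemma durrmeyer_sigma_bounds:
  assumes "x \<in> {0..1}" "n \<ge> 1"
  shows "0 < durrmeyer_sigma n x" "durrmeyer_sigma n x \<le> 1"
proof -
  define y where "y = real n - 1"
  have n: "real n = y + 1" and y: "0 \<le> y"
    using assms(2) by (simp_all add: y_def)
  \<comment> \<open>This uses that \<open>n\<close> is an integer: the product is negative strictly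
    between 1 and 2.\<close>
  have "0 \<le> (real n - 1) * (real n - 2)"
    using assms(2) by (cases "n = 1") auto
  moreover have xx: "0 \<le> x * (1 - x)" "x * (1 - x) \<le> 1"
    using assms(1) by (auto intro: mult_le_one)
  ultimately have nn: "0 \<le> x * (1 - x) * ((real n - 1) * (real n - 2))"
    and le: "x * (1 - x) * ((real n - 1) * (real n - 2)) \<le> (real n - 1) * (real n - 2)"
    by (auto intro: mult_left_le_one_le)
  show "0 < durrmeyer_sigma n x"
    unfolding durrmeyer_sigma_def using nn
    by (intro divide_pos_pos mult_pos_pos) (auto simp: mult.assoc)
  have "2 * x * (1 - x) * (real n - 1) * (real n - 2) + 3 * real n + 1
      \<le> 2 * ((real n - 1) * (real n - 2)) + 3 * real n + 1"
    using le by (simp add: mult.assoc)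
  \<comment> \<open>In \<open>y = n - 1\<close> the right side minus the left is a polynomial with
    nonnegative coefficients.\<close>
  also have "\<dots> \<le> 2 * (real n + 2)\<^sup>2 * (real n + 3)"
    unfolding n using y by (simp add: power2_eq_square algebra_simps)
  finally show "durrmeyer_sigma n x \<le> 1"
    unfolding durrmeyer_sigma_def by (intro divide_le_eq_1_pos[THEN iffD2]) auto
qed

theorem theorem7p2:
  fixes a0 a1 :: "nat \<Rightarrow> real" and f :: "real \<Rightarrow> real" and x :: real and n :: nat
  assumes "\<And>m. m \<ge> 1 \<Longrightarrow> 2 * a0 m + a1 m = 1"
    and "continuous_on {0..1} f"
    and "x \<in> {0..1}"
    and "n \<ge> 1"
  shows "\<bar>mod_durrmeyer a0 a1 n f x - f x\<bar>
    \<le> \<bar>durrmeyer n f x - f x\<bar>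
      + \<bar>(1 + a1 n) * (1 / 2 - x)\<bar>
        * (3 * omega2 f (sqrt (durrmeyer_sigma n x))
           + 5 / ((real n + 2) * sqrt (durrmeyer_sigma n x))
             * omega1 f (sqrt (durrmeyer_sigma n x)))"
proof -
  define h where "h = sqrt (durrmeyer_sigma n x)"
  define E where "E = 3 * omega2 f h + 5 / ((real n + 2) * h) * omega1 f h"
  have h: "0 < h" "h \<le> 1"
    using durrmeyer_sigma_bounds[OF assms(3,4)] by (auto simp: h_def)
  obtain m where m: "n = Suc m"
    using assms(4) by (cases n) auto
  \<comment> \<open>The least number of equal cells of length at most \<open>h\<close>. As
    \<open>h \<le> 1\<close>, \<open>N \<le> 1/h + 1 \<le> 2/h\<close>, well below
    \<open>5/h\<close>.\<close>
  define N where "N = nat \<lceil>1 / h\<rceil>"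
  have "1 / h \<le> real N" "real N \<le> 1 / h + 1"
    using h by (auto simp: N_def)
  then have N: "0 < N" "1 / real N \<le> h" "real N \<le> 5 / h"
  proof -
    show "0 < N"
      using h by (simp add: N_def)
    then show "1 / real N \<le> h"
      using h \<open>1 / h \<le> real N\<close> by (simp add: field_simps)
    have "1 \<le> 1 / h"
      using h by simp
    with \<open>real N \<le> 1 / h + 1\<close> show "real N \<le> 5 / h"
      by simp
  qed
  have o1: "0 \<le> omega1 f h"
    using omega1_upper[OF assms(2), of 0 0 h] h by simp
  have o2: "0 \<le> omega2 f h"
    using omega2_nonneg[OF assms(2)] h by simp
  define J where "J k = (real n + 1) * (integral {0..1} (\<lambda>t. Bernstein n k t * f t)
            - integral {0..1} (\<lambda>t. Bernstein n (Suc k) t * f t))" for k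
  have J: "\<bar>J k\<bar> \<le> E" if "k \<le> m" for k
  proof -
    have "\<bar>J k\<bar> \<le> real N * omega1 f h / (real n + 2) + 2 * omega2 f h"
      using Bernstein_weight_difference_bound[OF assms(2) N(1,2), of k n] that m
      by (simp add: J_def abs_mult)
    also have "\<dots> \<le> 5 / h * omega1 f h / (real n + 2) + 3 * omega2 f h"
      using N(3) o1 o2 by (intro add_mono divide_right_mono mult_right_mono) auto
    also have "\<dots> = E"
      by (simp add: E_def mult.commute)
    finally show ?thesis .
  qed
  \<comment> \<open>The weights \<open>p_{m,k}(x)\<close> are nonnegative with sum 1, so the average
    of the \<open>J k\<close> inherits their common bound.\<close>
  have "\<bar>\<Sum>k\<le>m. Bernstein m k x * J k\<bar> \<le> (\<Sum>k\<le>m. Bernstein m k x * E)"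
    using J Bernstein_nonneg[of x m] assms(3)
    by (intro order_trans[OF sum_abs] sum_mono) (auto simp: abs_mult intro!: mult_left_mono)
  also have "\<dots> = E"
    by (simp add: sum_distrib_right[symmetric] sum_Bernstein)
  finally have "\<bar>mod_durrmeyer a0 a1 n f x - durrmeyer n f x\<bar> \<le> \<bar>(1 + a1 n) * (x - 1 / 2)\<bar> * E"
    unfolding mod_durrmeyer_diff[of a0 n a1, OF assms(1)[OF assms(4)] m] J_def[symmetric] abs_mult
    by (rule mult_left_mono) simp
  also have "\<bar>(1 + a1 n) * (x - 1 / 2)\<bar> = \<bar>(1 + a1 n) * (1 / 2 - x)\<bar>"
    by (simp only: abs_mult abs_minus_commute)
  finally show ?thesis
    unfolding E_def h_def by linarith
qed

end
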